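(* Let $(\beta,\lessdot)=(E,\#,\mapsto,l,\lessdot)$ be a prioritized Bundle Event Structure and let $\lessdot'=\lessdot\setminus\{(e,e'),(e',e)\mid e\# e'\vee(\exists X\subseteq E.\ e\in X\wedge X\mapsto e')\}$. Then $\mathrm{Traces}(\beta,\lessdot)=\mathrm{Traces}(\beta,\lessdot')$.
   Context: A Bundle Event Structure (BES) is a quadruple $\beta=(E,\#,\mapsto,l)$ where $E$ is a set of events, $\#\subseteq E\times E$ is an irreflexive symmetric relation (conflict), $\mapsto\subseteq\mathcal{P}(E)\times E$ is the enabling relation (a pair $(X,e)$ is written $X\mapsto e$), and $l:E\to Act$ is a labeling function, satisfying Stability: whenever $X\mapsto e$, any two distinct $e_1,e_2\in X$ satisfy $e_1\# e_2$. For a finite sequence $\sigma=e_1\cdots e_n$ of events write $\bar\sigma=\{e_1,\dots,e_n\}$ and $\sigma_i=e_1\cdots e_i$ ($\sigma_0$ empty). Define $\mathrm{en}_\beta(\sigma)=\{e\in E\setminus\bar\sigma\mid (\forall X\subseteq E.\ X\mapsto e\Rightarrow X\cap\bar\sigma\neq\emptyset)\wedge\neg\exists e'\in\bar\sigma.\ e\# e'\}$. $\sigma$ is a trace of $\beta$ iff $e_i\in\mathrm{en}_\beta(\sigma_{i-1})$ for all $1\le i\le n$. A prioritized BES (PBES) $(\beta,\lessdot)$, also written $(E,\#,\mapsto,l,\lessdot)$, is a BES together with an acyclic relation $\lessdot\subseteq E\times E$ ($e\lessdot e'$: $e'$ has higher priority). $\sigma=e_1\cdots e_n$ is a trace of $(\beta,\lessdot)$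 iff $\sigma$ is a trace of $\beta$ and for all $0\le i<n$ and all $e_j,e_h\in\bar\sigma$ with $e_j\neq e_h$, $e_j,e_h\in\mathrm{en}_\beta(\sigma_i)$ and $e_h\lessdot e_j$, we have $j<h$; $\mathrm{Traces}(\beta,\lessdot)$ is the set of these traces (same definition for any subrelation of $\lessdot$). *)

theory Defs
  imports Main
begin

record ('e, 'act) bes_structure =
  events :: "'e set"
  conflict :: "('e \<times> 'e) set"
  enabling :: "('e set \<times> 'e) set"
  label :: "'e \<Rightarrow> 'act"

(* The set of actions is the type 'act; values of label outside events are irrelevant. *)
definition bes :: "('e, 'act) bes_structure \<Rightarrow> bool" where
  "bes \<beta> \<longleftrightarrow>
     conflict \<beta> \<subseteq> events \<beta> \<times> events \<beta> \<and> irrefl (conflict \<beta>) \<and> sym (conflict \<beta>) \<and>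
     enabling \<beta> \<subseteq> Pow (events \<beta>) \<times> events \<beta> \<and>
     (\<forall>X e. (X, e) \<in> enabling \<beta> \<longrightarrow>
        (\<forall>e1\<in>X. \<forall>e2\<in>X. e1 \<noteq> e2 \<longrightarrow> (e1, e2) \<in> conflict \<beta>))"

definition en :: "('e, 'act) bes_structure \<Rightarrow> 'e list \<Rightarrow> 'e set" where
  "en \<beta> \<sigma> = {e \<in> events \<beta> - set \<sigma>.
     (\<forall>X\<subseteq>events \<beta>. (X, e) \<in> enabling \<beta> \<longrightarrow> X \<inter> set \<sigma> \<noteq> {}) \<and>
     \<not> (\<exists>e'\<in>set \<sigma>. (e, e') \<in> conflict \<beta>)}"

(* Positions are counted from 0, so the event at position i must be enabled by the
   prefix take i \<sigma> of the i events preceding it. *)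
definition bes_trace :: "('e, 'act) bes_structure \<Rightarrow> 'e list \<Rightarrow> bool" where
  "bes_trace \<beta> \<sigma> \<longleftrightarrow> (\<forall>i<length \<sigma>. \<sigma> ! i \<in> en \<beta> (take i \<sigma>))"

(* (e, e') \<in> P means that e' has higher priority than e. *)
definition pbes :: "('e, 'act) bes_structure \<Rightarrow> ('e \<times> 'e) set \<Rightarrow> bool" where
  "pbes \<beta> P \<longleftrightarrow> bes \<beta> \<and> P \<subseteq> events \<beta> \<times> events \<beta> \<and> acyclic P"

definition Traces :: "('e, 'act) bes_structure \<Rightarrow> ('e \<times> 'e) set \<Rightarrow> 'e list set" where
  "Traces \<beta> P = {\<sigma>. bes_trace \<beta> \<sigma> \<and>
     (\<forall>i<length \<sigma>. \<forall>j<length \<sigma>. \<forall>h<length \<sigma>.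
        \<sigma> ! j \<noteq> \<sigma> ! h \<and> \<sigma> ! j \<in> en \<beta> (take i \<sigma>) \<and> \<sigma> ! h \<in> en \<beta> (take i \<sigma>) \<and>
        (\<sigma> ! h, \<sigma> ! j) \<in> P \<longrightarrow> j < h)}"

end

theory Submission
  imports Defs
begin

text \<open>The discarded pairs never constrain a trace: two events of a trace are not in conflict, and
  if two events are enabled at the same time then neither lies in a bundle of the other. Indeed,
  an event of that bundle must already have occurred, and by stability it would be in conflict
  with the other, still enabled, event of the bundle.\<close>

text \<open>Whichever event comes later was enabled by a prefix containing the earlier one, which
  excludes a conflict. Symmetry makes the order irrelevant, and irreflexivity covers equal
  positions.\<close>

lemma bes_trace_no_conflict:
  assumes "bes \<beta>" "bes_trace \<beta> \<sigma>" "a \<in> set \<sigma>" "b \<in> set \<sigma>"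
  shows "(a, b) \<notin> conflict \<beta>"
proof
  assume c: "(a, b) \<in> conflict \<beta>"
  have sy: "sym (conflict \<beta>)" and irr: "irrefl (conflict \<beta>)"
    using assms(1) by (auto simp: bes_def)
  have later: "(\<sigma> ! h, \<sigma> ! j) \<notin> conflict \<beta>" if "j < h" "h < length \<sigma>" for j h
  proof -
    have "\<sigma> ! j \<in> set (take h \<sigma>)"
      using that by (auto simp: in_set_conv_nth)
    then show ?thesis
      using assms(2) that by (auto simp: bes_trace_def en_def)
  qed
  obtain j h where jh: "j < length \<sigma>" "h < length \<sigma>" "a = \<sigma> ! j" "b = \<sigma> ! h"
    using assms(3,4) by (auto simp: in_set_conv_nth)
  consider "j < h" | "h < j" | "j = h" by linarith
  then show False
    using later jh c symD[OF sy c] irr by cases (auto simp: irrefl_def)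
qed

lemma en_not_in_bundle:
  assumes "bes \<beta>" "a \<in> en \<beta> \<sigma>" "b \<in> en \<beta> \<sigma>" "(X, b) \<in> enabling \<beta>"
  shows "a \<notin> X"
proof
  assume "a \<in> X"
  have "X \<subseteq> events \<beta>"
    using assms(1,4) by (auto simp: bes_def)
  then obtain c where c: "c \<in> X" "c \<in> set \<sigma>"
    using assms(3,4) unfolding en_def by blast
  \<comment> \<open>Stability speaks of distinct events only: \<open>c\<close> has occurred in
    \<open>\<sigma>\<close>, while an enabled event such as \<open>a\<close> has not.\<close>
  then have "a \<noteq> c"
    using assms(2) by (auto simp: en_def)
  then have "(a, c) \<in> conflict \<beta>"
    using assms(1,4) \<open>a \<in> X\<close> c by (auto simp: bes_def)
  then show False
    using assms(2) c by (auto simp: en_def)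
qed

text \<open>A priority relation is consulted only at pairs of events of the trace that some prefix
  enables together. The list \<open>\<tau>\<close> stands for that prefix
  \<open>take i \<sigma>\<close>.\<close>

lemma Traces_eqI:
  assumes "\<And>\<sigma> \<tau> a b. bes_trace \<beta> \<sigma> \<Longrightarrow> a \<in> set \<sigma> \<Longrightarrow> b \<in> set \<sigma> \<Longrightarrow>
    a \<in> en \<beta> \<tau> \<Longrightarrow> b \<in> en \<beta> \<tau> \<Longrightarrow> (a, b) \<in> P \<longleftrightarrow> (a, b) \<in> Q"
  shows "Traces \<beta> P = Traces \<beta> Q"
  unfolding Traces_def using assms by (intro Collect_cong) (meson nth_mem)

theorem theorem3:
  fixes \<beta> :: "('e, 'act) bes_structure" and P P' :: "('e \<times> 'e) set"
  assumes "pbes \<beta> P"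
    and "P' = P - \<Union> {{(e, e'), (e', e)} | e e'.
           (e, e') \<in> conflict \<beta> \<or>
           (\<exists>X\<subseteq>events \<beta>. e \<in> X \<and> (X, e') \<in> enabling \<beta>)}"
  shows "Traces \<beta> P = Traces \<beta> P'"
proof (rule Traces_eqI)
  fix \<sigma> \<tau> a b
  assume tr: "bes_trace \<beta> \<sigma>" "a \<in> set \<sigma>" "b \<in> set \<sigma>" and en: "a \<in> en \<beta> \<tau>" "b \<in> en \<beta> \<tau>"
  have b: "bes \<beta>"
    using assms(1) by (simp add: pbes_def)
  \<comment> \<open>Pairs are removed in both orientations, so conflict and bundle membership are
    each refuted both ways.\<close>
  have "(a, b) \<notin> conflict \<beta>" "(b, a) \<notin> conflict \<beta>"
    using bes_trace_no_conflict[OF b tr(1)] tr by auto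
  moreover have "a \<notin> X" if "(X, b) \<in> enabling \<beta>" for X
    using en_not_in_bundle[OF b en that] .
  moreover have "b \<notin> X" if "(X, a) \<in> enabling \<beta>" for X
    using en_not_in_bundle[OF b en(2,1) that] .
  ultimately show "(a, b) \<in> P \<longleftrightarrow> (a, b) \<in> P'"
    unfolding assms(2) by auto
qed

end
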